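(* Let $s\geqslant 0$ be an integer. If $n=2s+1$, then (with corresponding signs) $$t_n(x)\pm 2=(x\pm 2)\,p^\mp_s(x)^2 .$$ If $n=2s$, then $$t_n(x)+2=q^-_s(x)^2=t_s(x)^2,\qquad t_n(x)-2=(x^2-4)\,\frac{q^+_s(x)^2}{x^2}=(x^2-4)\,c_{s-1}(x)^2 .$$
   Context: The polynomials $t_n(x)=2\,T_n(x/2)$ are rescaled Chebyshev polynomials of the first kind: $t_0(x)=2$, $t_1(x)=x$, $t_n(x)=x\,t_{n-1}(x)-t_{n-2}(x)$ for $n\geqslant 2$. The polynomials $c_n(x)\in\mathbb{Z}[x]$, $n\geqslant -2$, are defined by $c_{-2}(x)=-1$, $c_{-1}(x)=0$, $c_0(x)=1$, $c_1(x)=x$ and $c_n(x)=x\,c_{n-1}(x)-c_{n-2}(x)$ for $n\geqslant 2$. For $n\geqslant 0$ put $p^\pm_n(x)=c_n(x)\pm c_{n-1}(x)$ and $q^\pm_n(x)=c_n(x)\pm c_{n-2}(x)$ (corresponding signs). *)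

theory Defs
  imports
    "HOL-Computational_Algebra.Polynomial"
    "HOL-Computational_Algebra.Polynomial_Factorial"
begin

abbreviation X :: "int poly" where
  "X \<equiv> [:0, 1:]"

fun cheb_t :: "nat \<Rightarrow> int poly" where
  "cheb_t 0 = 2"
| "cheb_t (Suc 0) = X"
| "cheb_t (Suc (Suc n)) = X * cheb_t (Suc n) - cheb_t n"

text \<open>The index of \<open>c\<close> runs over the integers \<open>n \<ge> -2\<close>; the value \<open>0\<close> for
  \<open>n < -2\<close> is a dummy.\<close>

function cheb_c :: "int \<Rightarrow> int poly" where
  "cheb_c n =
    (if n < -2 then 0
     else if n = -2 then -1
     else if n = -1 then 0
     else if n = 0 then 1
     else if n = 1 then X
     else X * cheb_c (n - 1) - cheb_c (n - 2))"
  by pat_completeness auto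
termination
  by (relation "measure (\<lambda>n. nat (n + 2))") auto

declare cheb_c.simps [simp del]

definition p_plus :: "nat \<Rightarrow> int poly" where
  "p_plus n = cheb_c (int n) + cheb_c (int n - 1)"

definition p_minus :: "nat \<Rightarrow> int poly" where
  "p_minus n = cheb_c (int n) - cheb_c (int n - 1)"

definition q_plus :: "nat \<Rightarrow> int poly" where
  "q_plus n = cheb_c (int n) + cheb_c (int n - 2)"

definition q_minus :: "nat \<Rightarrow> int poly" where
  "q_minus n = cheb_c (int n) - cheb_c (int n - 2)"

text \<open>The Chebyshev polynomials of the first kind appear only in the following check that
  \<open>t\<^sub>n(x) = 2 T\<^sub>n(x/2)\<close>.\<close>

fun cheb_T :: "nat \<Rightarrow> real poly" where
  "cheb_T 0 = 1"
| "cheb_T (Suc 0) = [:0, 1:]"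
| "cheb_T (Suc (Suc n)) = [:0, 2:] * cheb_T (Suc n) - cheb_T n"

lemma cheb_t_eq_cheb_T:
  "poly (map_poly real_of_int (cheb_t n)) x = 2 * poly (cheb_T n) (x / 2)"
proof (induction n rule: cheb_t.induct)
  case 1
  have "(2 :: int poly) = [:2:]" by (simp add: numeral_poly)
  then have "cheb_t 0 = [:2:]" by simp
  then show ?case by (simp only: map_poly_pCons) (simp add: map_poly_pCons)
next
  case 2
  show ?case by (simp add: map_poly_pCons)
next
  case (3 n)
  have diff: "map_poly real_of_int (p - q) = map_poly real_of_int p - map_poly real_of_int q"
    for p q by (rule poly_eqI) (simp add: coeff_map_poly)
  have X: "map_poly real_of_int (X * p) = [:0, 1:] * map_poly real_of_int p" for p
    by (simp add: map_poly_pCons)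
  show ?case
    using 3 by (simp only: cheb_t.simps cheb_T.simps diff X) (simp add: algebra_simps)
qed

end

theory Submission
  imports Defs
begin

text \<open>
  Put \<open>a = c\<^sub>s\<close> and \<open>b = c\<^sub>s\<^sub>-\<^sub>1\<close>. Stepping \<open>s\<close> replaces \<open>(a, b)\<close> by \<open>(x a - b, a)\<close>, and this
  linear map preserves the quadratic form \<open>a\<^sup>2 - x a b + b\<^sup>2\<close>, whose value is therefore always \<open>1\<close>
  (\<open>cheb_c_invariant\<close>). Every square in the theorem is the square of a linear form in \<open>(a, b)\<close>:
  \<open>p\<^sup>\<plusminus>\<^sub>s = a \<plusminus> b\<close>, \<open>q\<^sup>+\<^sub>s = x b\<close> and \<open>q\<^sup>-\<^sub>s = t\<^sub>s = 2 a - x b\<close>. Multiplying the constants \<open>\<plusminus>2\<close> by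
  the quadratic form makes all claims identities between quadratic forms in \<open>a\<close> and \<open>b\<close>.

  The two formulas of each parity differ by \<open>4 = 4 (a\<^sup>2 - x a b + b\<^sup>2\<close>), so one of each suffices.
  These two, \<open>t\<^sub>2\<^sub>s - 2 = (x\<^sup>2 - 4) b\<^sup>2\<close> and \<open>t\<^sub>2\<^sub>s\<^sub>+\<^sub>1 + 2 = (x + 2) (a - b)\<^sup>2\<close>, are proved by a joint
  induction on \<open>s\<close> (\<open>cheb_t_even_odd\<close>), because the recurrence for \<open>t\<close> alternates between the
  parities.
\<close>

text \<open>The starting value \<open>c\<^sub>-\<^sub>2 = -1\<close> extends the recurrence down to the indices \<open>0\<close> and \<open>1\<close>, so
  that no identity below needs separate small cases.\<close>

lemma cheb_c_rec:
  assumes "n \<ge> 0"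
  shows "cheb_c n = X * cheb_c (n - 1) - cheb_c (n - 2)"
proof -
  have small: "cheb_c (- 2) = - 1" "cheb_c (- 1) = 0" "cheb_c 0 = 1" "cheb_c 1 = X"
    by (simp_all add: cheb_c.simps)
  consider "n = 0" | "n = 1" | "n \<ge> 2"
    using assms by linarith
  then show ?thesis
  proof cases
    case 3
    then show ?thesis by (subst cheb_c.simps) simp
  qed (simp_all add: small)
qed

lemma cheb_c_int_Suc:
  "cheb_c (int (Suc s)) = X * cheb_c (int s) - cheb_c (int s - 1)"
  using cheb_c_rec[of "int (Suc s)"] by simp

lemma cheb_c_0: "cheb_c 0 = 1" and cheb_c_minus_1: "cheb_c (- 1) = 0"
  by (simp_all add: cheb_c.simps)

text \<open>The form on the left is invariant under the substitution \<open>(a, b) \<mapsto> (x a - b, a)\<close>, and it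
  equals \<open>1\<close> at the start \<open>(c\<^sub>0, c\<^sub>-\<^sub>1) = (1, 0)\<close>.\<close>

lemma cheb_c_invariant:
  "(cheb_c (int s))\<^sup>2 - X * cheb_c (int s) * cheb_c (int s - 1) + (cheb_c (int s - 1))\<^sup>2 = 1"
proof (induction s)
  case 0
  then show ?case by (simp add: cheb_c_0 cheb_c_minus_1)
next
  case (Suc s)
  have "(x * a - b)\<^sup>2 - x * (x * a - b) * a + a\<^sup>2 = a\<^sup>2 - x * a * b + b\<^sup>2" for x a b :: "int poly"
    by algebra
  from this[of X "cheb_c (int s)" "cheb_c (int s - 1)"] Suc show ?case
    by (simp only: cheb_c_int_Suc) simp
qed

lemma q_plus_eq: "q_plus s = X * cheb_c (int s - 1)"
  using cheb_c_rec[of "int s"] by (simp add: q_plus_def)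

lemma q_minus_eq: "q_minus s = 2 * cheb_c (int s) - X * cheb_c (int s - 1)"
proof -
  have "a - d = 2 * a - x * b" if "a = x * b - d" for a b d x :: "int poly"
    using that by algebra
  from this[OF cheb_c_rec[of "int s"]] show ?thesis
    by (simp only: q_minus_def of_nat_0_le_iff)
qed

text \<open>As \<open>q\<^sup>-\<close> is a combination of two shifts of \<open>c\<close>, it satisfies the recurrence of \<open>t\<close>, and both
  sequences start with \<open>2, x\<close>.\<close>

lemma cheb_t_eq_q_minus: "cheb_t s = q_minus s"
proof -
  have "cheb_t s = q_minus s \<and> cheb_t (Suc s) = q_minus (Suc s)"
  proof (induction s)
    case 0
    have "q_minus 0 = 2" "q_minus (Suc 0) = X"
      unfolding q_minus_eq cheb_c_int_Suc by (simp_all add: cheb_c_0 cheb_c_minus_1)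
    then show ?case by simp
  next
    case (Suc s)
    have rec: "2 * (x * (x * a - b) - a) - x * (x * a - b)
        = x * (2 * (x * a - b) - x * a) - (2 * a - x * b)" for x a b :: "int poly"
      by algebra
    have pred: "cheb_c (int (Suc k) - 1) = cheb_c (int k)" for k
      by simp
    have "q_minus (Suc (Suc s)) = X * q_minus (Suc s) - q_minus s"
      unfolding q_minus_eq pred cheb_c_int_Suc by (rule rec)
    with Suc show ?case by simp
  qed
  then show ?thesis by simp
qed

lemma cheb_t_even_odd:
  "cheb_t (2 * s) - 2 = (X\<^sup>2 - 4) * (cheb_c (int s - 1))\<^sup>2 \<and>
   cheb_t (2 * s + 1) + 2 = (X + 2) * (cheb_c (int s) - cheb_c (int s - 1))\<^sup>2"
proof (induction s)
  case 0
  then show ?case by (simp add: cheb_c_0 cheb_c_minus_1)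
next
  case (Suc s)
  define u v where "u = cheb_t (2 * s)" and "v = cheb_t (2 * s + 1)"
  define a b where "a = cheb_c (int s)" and "b = cheb_c (int s - 1)"
  have step: "x * v - u - 2 = (x\<^sup>2 - 4) * a\<^sup>2 \<and>
      x * (x * v - u) - v + 2 = (x + 2) * ((x * a - b) - a)\<^sup>2"
    if "u - 2 = (x\<^sup>2 - 4) * b\<^sup>2" "v + 2 = (x + 2) * (a - b)\<^sup>2" "a\<^sup>2 - x * a * b + b\<^sup>2 = 1"
    for x a b u v :: "int poly"
  proof -
    from that(1,2) have u: "u = (x\<^sup>2 - 4) * b\<^sup>2 + 2" and v: "v = (x + 2) * (a - b)\<^sup>2 - 2"
      by (simp_all add: algebra_simps)
    show ?thesis
      unfolding u v using that(3) by (intro conjI; algebra)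
  qed
  have "X * v - u - 2 = (X\<^sup>2 - 4) * a\<^sup>2 \<and>
      X * (X * v - u) - v + 2 = (X + 2) * ((X * a - b) - a)\<^sup>2"
    using Suc cheb_c_invariant[of s] unfolding u_def v_def a_def b_def by (intro step) blast+
  moreover have "cheb_t (2 * Suc s) = X * v - u" "cheb_t (2 * Suc s + 1) = X * (X * v - u) - v"
    by (simp_all add: u_def v_def)
  moreover have "cheb_c (int (Suc s)) = X * a - b" "cheb_c (int (Suc s) - 1) = a"
    unfolding a_def b_def cheb_c_int_Suc by simp_all
  ultimately show ?case by (simp only:)
qed

theorem theorem2p2:
  fixes s n :: nat
  shows
    "(n = 2 * s + 1 \<longrightarrow>
        cheb_t n + 2 = (X + 2) * (p_minus s)\<^sup>2 \<and>
        cheb_t n - 2 = (X - 2) * (p_plus s)\<^sup>2) \<and>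
     (n = 2 * s \<longrightarrow>
        cheb_t n + 2 = (q_minus s)\<^sup>2 \<and>
        (q_minus s)\<^sup>2 = (cheb_t s)\<^sup>2 \<and>
        to_fract (cheb_t n - 2) =
          to_fract (X\<^sup>2 - 4) * (to_fract ((q_plus s)\<^sup>2) / to_fract (X\<^sup>2)) \<and>
        to_fract (X\<^sup>2 - 4) * (to_fract ((q_plus s)\<^sup>2) / to_fract (X\<^sup>2)) =
          to_fract ((X\<^sup>2 - 4) * (cheb_c (int s - 1))\<^sup>2))"
proof -
  define a b where "a = cheb_c (int s)" and "b = cheb_c (int s - 1)"
  have inv: "a\<^sup>2 - X * a * b + b\<^sup>2 = 1"
    unfolding a_def b_def by (rule cheb_c_invariant)
  have even: "cheb_t (2 * s) - 2 = (X\<^sup>2 - 4) * b\<^sup>2"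
    and odd: "cheb_t (2 * s + 1) + 2 = (X + 2) * (a - b)\<^sup>2"
    using cheb_t_even_odd[of s] by (simp_all only: a_def b_def)
  have other_sign: "v - 2 = (x - 2) * (a + b)\<^sup>2"
    if "v + 2 = (x + 2) * (a - b)\<^sup>2" "a\<^sup>2 - x * a * b + b\<^sup>2 = 1" for x a b v :: "int poly"
    using that by algebra
  have square: "u + 2 = (2 * a - x * b)\<^sup>2"
    if "u - 2 = (x\<^sup>2 - 4) * b\<^sup>2" "a\<^sup>2 - x * a * b + b\<^sup>2 = 1" for x a b u :: "int poly"
    using that by algebra
  have cancel: "to_fract ((q_plus s)\<^sup>2) / to_fract (X\<^sup>2) = to_fract (b\<^sup>2)"
  proof -
    have "to_fract (X\<^sup>2) \<noteq> 0" by (simp add: to_fract_eq_0_iff)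
    then show ?thesis
      unfolding q_plus_eq b_def[symmetric] power_mult_distrib to_fract_mult by simp
  qed
  have "cheb_t (2 * s + 1) + 2 = (X + 2) * (p_minus s)\<^sup>2"
    using odd by (simp only: p_minus_def a_def b_def)
  moreover have "cheb_t (2 * s + 1) - 2 = (X - 2) * (p_plus s)\<^sup>2"
    using other_sign[OF odd inv] by (simp only: p_plus_def a_def b_def)
  moreover have "cheb_t (2 * s) + 2 = (q_minus s)\<^sup>2"
    using square[OF even inv] by (simp only: q_minus_eq a_def b_def)
  moreover have "to_fract (X\<^sup>2 - 4) * (to_fract ((q_plus s)\<^sup>2) / to_fract (X\<^sup>2))
      = to_fract ((X\<^sup>2 - 4) * b\<^sup>2)"
    by (simp only: cancel to_fract_mult)
  moreover have "(q_minus s)\<^sup>2 = (cheb_t s)\<^sup>2"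
    by (simp only: cheb_t_eq_q_minus)
  ultimately show ?thesis
    using even unfolding b_def by metis
qed

end
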